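(* Consider the random difference equation $x_{n+1}=h(x_n,\omega_n)$ satisfying (H1) and (H2) (see context; $k\in\mathbb N_0$ is the exponent appearing in (H2)). Let the interval $M\subset X$ be the support of a stationary distribution of this equation, with density $\phi:M\to\mathbb{R}_+=[0,\infty)$. Suppose that the upper extremal map $h_+$ is a $C^2$-(local) diffeomorphism, and that $x_+:=\sup M<\infty$ is a hyperbolic fixed point of $h_+$ such that $$h_+(x)=x_++\lambda(x-x_+)+o(x_+-x)\quad\text{as }x\to x_+$$ for some $\lambda\in(0,1)$. Then $$\lim_{x\to x_+}\frac{\ln\phi(x)}{\big(\ln(x_+-x)\big)^2}=\frac{k+1}{2\ln\lambda},$$ where the limit is taken over $x\in M$, $x<x_+$.
   Context: Setting. $X\subset\mathbb{R}$ is an interval, $\Delta=[-1,1]$, and $h:X\times\Delta\to X$ is continuously differentiable. $(\omega_n)_{n\ge0}$ is an i.i.d. sequence in $\Delta$ with common law $\nu$, a Borel probability measure with $\operatorname{supp}\nu=\Delta$. The Markov process is $x_{n+1}=h(x_n,\omega_n)$. (H1) Monotonicity: $\partial_xh(x,\omega)>0$ and $\partial_\omega h(x,\omega)>0$ for all $(x,\omega)\in X\times\Delta$. (H2) Shape of the noise density: $\nu$ is absolutely continuous with respect to Lebesgue measure, and its density $p:\Delta\to[0,\infty)$ is a $C^k$ function for some $k\in\mathbb{N}_0$ such that $p(\omega)>0$ for every $\omega\in(-1,1)$ and, for some $\beta>0$, $p(\omega)=\beta(1-\omega)^k+o((1-\omega)^k)$ as $\omega\to1$. Extremal maps: $h_\pm(x):=h(x,\pm1)$;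 $h_+$ is the upper extremal map. Stationary distribution: a Borel probability measure $\mu$ on $X$ with $\mu(A)=\int_X\nu(\{\omega\in\Delta:h(x,\omega)\in A\})\,d\mu(x)$ for all Borel $A\subset X$. Any such $\mu$ is absolutely continuous with respect to Lebesgue measure. Its density $\phi$ is taken to be the representative satisfying the fixed point equation of the transfer operator pointwise: $$\phi(x)=\int_{\{y\in M:\ h_-(y)\le x\le h_+(y)\}}\frac{p(h_y^{-1}(x))}{\partial_\omega h(y,h_y^{-1}(x))}\,\phi(y)\,dy,$$ where $h_y^{-1}(x)$ denotes the unique $\omega\in\Delta$ with $h(y,\omega)=x$. *)

theory Defs
  imports "HOL-Probability.Probability" "HOL-Library.Landau_Symbols"
begin

abbreviation \<Delta> :: "real set" where
  "\<Delta> \<equiv> {-1..1}"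

text \<open>
  Differentiability is always taken within the given set, so derivatives at boundary points of an
  interval or a rectangle are one-sided.  The sets to which the following definitions are applied
  (nondegenerate intervals, relatively open subsets and products of such) determine these
  derivatives uniquely.
\<close>

fun Ck_on :: "nat \<Rightarrow> (real \<Rightarrow> real) \<Rightarrow> real set \<Rightarrow> bool" where
  "Ck_on 0 f S \<longleftrightarrow> continuous_on S f"
| "Ck_on (Suc n) f S \<longleftrightarrow>
     (\<exists>f'. (\<forall>x\<in>S. (f has_real_derivative f' x) (at x within S)) \<and> Ck_on n f' S)"

definition continuously_differentiable_on ::
    "('a::real_normed_vector \<Rightarrow> 'b::real_normed_vector) \<Rightarrow> 'a set \<Rightarrow> bool" where
  "continuously_differentiable_on f S \<longleftrightarrow>
     (\<exists>D :: 'a \<Rightarrow> 'a \<Rightarrow>\<^sub>L 'b.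
        (\<forall>z\<in>S. (f has_derivative blinfun_apply (D z)) (at z within S)) \<and> continuous_on S D)"

text \<open>
  A local diffeomorphism is understood onto its image: \<open>f\<close> is only defined on \<open>S\<close>, neighbourhoods
  are relative to \<open>S\<close>, and the image of \<open>S\<close> need not be open.
\<close>

definition local_Ck_diffeomorphism_on :: "nat \<Rightarrow> (real \<Rightarrow> real) \<Rightarrow> real set \<Rightarrow> bool" where
  "local_Ck_diffeomorphism_on n f S \<longleftrightarrow>
     (\<forall>a\<in>S. \<exists>U. open U \<and> a \<in> U \<and> Ck_on n f (S \<inter> U) \<and>
        (\<exists>g. (\<forall>x\<in>S \<inter> U. g (f x) = x) \<and> Ck_on n g (f ` (S \<inter> U))))"

definition hyperbolic_fixed_point_on :: "(real \<Rightarrow> real) \<Rightarrow> real set \<Rightarrow> real \<Rightarrow> bool" where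
  "hyperbolic_fixed_point_on f S a \<longleftrightarrow> a \<in> S \<and> f a = a \<and>
     (\<exists>D. (f has_real_derivative D) (at a within S) \<and> \<bar>D\<bar> \<noteq> 1)"

text \<open>For a measure on the Borel sets of a subspace, the support is relative to that subspace.\<close>

definition measure_support :: "'a::topological_space measure \<Rightarrow> 'a set" where
  "measure_support N =
     {x \<in> space N. \<forall>U. open U \<longrightarrow> x \<in> U \<longrightarrow> emeasure N (U \<inter> space N) > 0}"

definition partial_x :: "real set \<Rightarrow> (real \<Rightarrow> real \<Rightarrow> real) \<Rightarrow> real \<Rightarrow> real \<Rightarrow> real" where
  "partial_x X h x w = vector_derivative (\<lambda>x'. h x' w) (at x within X)"

definition partial_noise :: "(real \<Rightarrow> real \<Rightarrow> real) \<Rightarrow> real \<Rightarrow> real \<Rightarrow> real" where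
  "partial_noise h x w = vector_derivative (\<lambda>w'. h x w') (at w within \<Delta>)"

text \<open>
  The equation \<open>x\<^sub>n\<^sub>+\<^sub>1 = h x\<^sub>n \<omega>\<^sub>n\<close> with i.i.d. noise on \<open>\<Delta>\<close> is given by its data: the state space \<open>X\<close>,
  the map \<open>h\<close> and the common law \<open>\<nu>\<close> of the noise.
\<close>

definition random_difference_equation ::
    "real set \<Rightarrow> (real \<Rightarrow> real \<Rightarrow> real) \<Rightarrow> real measure \<Rightarrow> bool" where
  "random_difference_equation X h \<nu> \<longleftrightarrow>
     is_interval X \<and>
     (\<forall>x\<in>X. \<forall>w\<in>\<Delta>. h x w \<in> X) \<and>
     continuously_differentiable_on (\<lambda>(x, w). h x w) (X \<times> \<Delta>) \<and>
     prob_space \<nu> \<and> sets \<nu> = sets (restrict_space borel \<Delta>) \<and> measure_support \<nu> = \<Delta>"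

definition H1 :: "real set \<Rightarrow> (real \<Rightarrow> real \<Rightarrow> real) \<Rightarrow> bool" where
  "H1 X h \<longleftrightarrow> (\<forall>x\<in>X. \<forall>w\<in>\<Delta>. partial_x X h x w > 0 \<and> partial_noise h x w > 0)"

definition H2 :: "real measure \<Rightarrow> (real \<Rightarrow> real) \<Rightarrow> nat \<Rightarrow> bool" where
  "H2 \<nu> p k \<longleftrightarrow>
     absolutely_continuous (restrict_space lborel \<Delta>) \<nu> \<and>
     \<nu> = density (restrict_space lborel \<Delta>) (\<lambda>w. ennreal (p w)) \<and>
     Ck_on k p \<Delta> \<and>
     (\<forall>w\<in>\<Delta>. p w \<ge> 0) \<and>
     (\<forall>w\<in>{-1<..<1}. p w > 0) \<and>
     (\<exists>\<beta>>0. (\<lambda>w. p w - \<beta> * (1 - w) ^ k) \<in> o[at_left 1](\<lambda>w. (1 - w) ^ k))"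

definition upper_map :: "(real \<Rightarrow> real \<Rightarrow> real) \<Rightarrow> real \<Rightarrow> real" where
  "upper_map h x = h x 1"

definition lower_map :: "(real \<Rightarrow> real \<Rightarrow> real) \<Rightarrow> real \<Rightarrow> real" where
  "lower_map h x = h x (-1)"

definition stationary_distribution ::
    "real set \<Rightarrow> (real \<Rightarrow> real \<Rightarrow> real) \<Rightarrow> real measure \<Rightarrow> real measure \<Rightarrow> bool" where
  "stationary_distribution X h \<nu> \<mu> \<longleftrightarrow>
     prob_space \<mu> \<and> sets \<mu> = sets (restrict_space borel X) \<and>
     (\<forall>A\<in>sets \<mu>. emeasure \<mu> A = (\<integral>\<^sup>+x. emeasure \<nu> {w\<in>\<Delta>. h x w \<in> A} \<partial>\<mu>))"

text \<open>
  Only the values of \<open>\<phi>\<close> on \<open>M\<close> matter.  The fixed point equation uses the integral in \<open>[0,\<infinity>]\<close>,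
  so that it includes the finiteness of the right-hand side.
\<close>

definition stationary_density ::
    "real set \<Rightarrow> (real \<Rightarrow> real \<Rightarrow> real) \<Rightarrow> (real \<Rightarrow> real) \<Rightarrow> real measure \<Rightarrow> real set
      \<Rightarrow> (real \<Rightarrow> real) \<Rightarrow> bool" where
  "stationary_density X h p \<mu> M \<phi> \<longleftrightarrow>
     \<phi> \<in> borel_measurable (restrict_space borel M) \<and>
     (\<forall>x\<in>M. \<phi> x \<ge> 0) \<and>
     \<mu> = density (restrict_space lborel X) (\<lambda>x. ennreal (\<phi> x) * indicator M x) \<and>
     (\<forall>x\<in>M. ennreal (\<phi> x) =
        (\<integral>\<^sup>+y\<in>{y\<in>M. lower_map h y \<le> x \<and> x \<le> upper_map h y}.
           (let w = the_inv_into \<Delta> (h y) x in ennreal (p w / partial_noise h y w * \<phi> y))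
         \<partial>lborel))"

end

(*
  Let F t be the stationary mass of [xp - t, xp].  Near xp the transfer kernel behaves like
  (h_+ y - x)^k up to constants, and x \<le> h_+ y means, up to an arbitrarily small change of lam, that
  y \<ge> xp - (xp - x) / lam.  Hence \<phi> (xp - t) is comparable to t^k F (t / l), from above for l < lam and
  from below for l > lam; integrating, F t is comparable to t^(k+1) F (t / l).  In the variable
  u = - ln t this is a difference inequality with step L = - ln l whose solutions grow like
  - (k + 1) u^2 / (2 L), and l tends to lam at the end.
*)

theory Submission
  imports Defs "HOL-Real_Asymp.Real_Asymp"
begin

text \<open>The density enters its own equation through an integral and need not be monotone, so it
  cannot be iterated pointwise. F is monotone and at most 1, and it closes into scalar inequalities
  between F t and F (t / l). Multiplicative constants become additive under ln and are applied about
  u / L times, so they cost only O(u), which division by u^2 removes. Crude comparisons therefore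
  suffice, and only the rate l has to become sharp. The two directions are not symmetric. From
  above, s^k F (s / l) is largest at the far end s = t. From below there are two losses: the kernel
  vanishes where x = h_+ y if k > 0, and F (s / l) is smaller for s < t. Each is paid for by a
  slightly larger l. Since the equation for \<phi> holds pointwise, the bounds hold at every x near
  xp, as a limit along all of M demands.\<close>

section \<open>Slice derivatives and monotonicity on intervals\<close>

lemma Ck_on_imp_continuous_on: "Ck_on n f S \<Longrightarrow> continuous_on S f"
  by (cases n) (auto intro: has_field_derivative_at_within DERIV_continuous
      simp: continuous_on_eq_continuous_within)

text \<open>The joint derivative is restricted to horizontal and vertical slices. Joint continuity
  of \<open>Dw\<close> later keeps the noise derivative close to its value at \<open>(xp, 1)\<close>
  for all nearby states at once.\<close>

lemma continuously_differentiable_on_partials: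
  fixes h :: "real \<Rightarrow> real \<Rightarrow> real"
  assumes "continuously_differentiable_on (\<lambda>(x, w). h x w) (S \<times> T)"
  obtains Dw Dx :: "real \<times> real \<Rightarrow> real" where
    "continuous_on (S \<times> T) Dw"
    "\<And>x w. x \<in> S \<Longrightarrow> w \<in> T \<Longrightarrow> ((\<lambda>x. h x w) has_real_derivative Dx (x, w)) (at x within S)"
    "\<And>x w. x \<in> S \<Longrightarrow> w \<in> T \<Longrightarrow> (h x has_real_derivative Dw (x, w)) (at w within T)"
proof -
  obtain D :: "real \<times> real \<Rightarrow> (real \<times> real) \<Rightarrow>\<^sub>L real" where
    D: "\<And>z. z \<in> S \<times> T \<Longrightarrow> ((\<lambda>(x, w). h x w) has_derivative D z) (at z within S \<times> T)"
    and contD: "continuous_on (S \<times> T) D"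
    using assms unfolding continuously_differentiable_on_def by blast
  show thesis
  proof (rule that)
    show "continuous_on (S \<times> T) (\<lambda>z. D z (0, 1))"
      by (intro continuous_intros contD)
  next
    fix x w assume xw: "x \<in> S" "w \<in> T"
    have "((\<lambda>(x, w). h x w) has_derivative D (x, w)) (at (x, w) within (\<lambda>x. (x, w)) ` S)"
      by (rule has_derivative_subset[OF D]) (use xw in auto)
    then have "((\<lambda>x. h x w) has_derivative (\<lambda>d. D (x, w) (d, 0))) (at x within S)"
      using has_derivative_in_compose[of "\<lambda>x. (x, w)" "\<lambda>d. (d, 0)" x S "\<lambda>(x, w). h x w" "D (x, w)"]
      by (simp add: has_derivative_Pair)
    moreover have "(\<lambda>d. D (x, w) (d, 0)) = (*) (D (x, w) (1, 0))"
    proof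
      fix d :: real
      show "D (x, w) (d, 0) = D (x, w) (1, 0) * d"
        using blinfun.scaleR_right[of "D (x, w)" d "(1, 0)"] by simp
    qed
    ultimately show "((\<lambda>x. h x w) has_real_derivative D (x, w) (1, 0)) (at x within S)"
      by (simp only: has_field_derivative_def)
  next
    fix x w assume xw: "x \<in> S" "w \<in> T"
    have "((\<lambda>(x, w). h x w) has_derivative D (x, w)) (at (x, w) within (\<lambda>w. (x, w)) ` T)"
      by (rule has_derivative_subset[OF D]) (use xw in auto)
    then have "(h x has_derivative (\<lambda>d. D (x, w) (0, d))) (at w within T)"
      using has_derivative_in_compose[of "\<lambda>w. (x, w)" "\<lambda>d. (0, d)" w T "\<lambda>(x, w). h x w" "D (x, w)"]
      by (simp add: has_derivative_Pair)
    moreover have "(\<lambda>d. D (x, w) (0, d)) = (*) (D (x, w) (0, 1))"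
    proof
      fix d :: real
      show "D (x, w) (0, d) = D (x, w) (0, 1) * d"
        using blinfun.scaleR_right[of "D (x, w)" d "(0, 1)"] by simp
    qed
    ultimately show "(h x has_real_derivative D (x, w) (0, 1)) (at w within T)"
      by (simp only: has_field_derivative_def)
  qed
qed

text \<open>The second point \<open>y\<close> excludes a one-point interval, so \<open>x\<close> is
  a limit point of \<open>S\<close> and the derivative within \<open>S\<close> is unique. This gives
  access to \<open>partial_x\<close> and \<open>partial_noise\<close>, which are defined by
  choice.\<close>

lemma vector_derivative_within_interval:
  fixes f :: "real \<Rightarrow> real"
  assumes "is_interval S" "x \<in> S" "y \<in> S" "x \<noteq> y"
    and "(f has_real_derivative D) (at x within S)"
  shows "vector_derivative f (at x within S) = D"
proof (rule vector_derivative_within)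
  have "S \<noteq> {z}" for z
    using assms by auto
  then show "at x within S \<noteq> bot"
    using connected_imp_perfect[of S x] assms(1,2) is_interval_connected_1[of S]
    by (simp add: trivial_limit_within)
  show "(f has_vector_derivative D) (at x within S)"
    using assms(5) by (simp add: has_real_derivative_iff_has_vector_derivative)
qed

lemma strict_mono_on_interval_if_derivative_pos:
  fixes f :: "real \<Rightarrow> real"
  assumes S: "is_interval S"
    and f: "\<And>x. x \<in> S \<Longrightarrow> (f has_real_derivative f' x) (at x within S)"
    and pos: "\<And>x. x \<in> S \<Longrightarrow> f' x > 0"
  shows "strict_mono_on S f"
proof (rule strict_mono_onI)
  fix a b assume ab: "a \<in> S" "b \<in> S" "a < b"
  have sub: "{a..b} \<subseteq> S"
    using mem_is_interval_1_I[OF S ab(1,2)] by auto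
  have "\<exists>z\<in>{a<..<b}. f b - f a = f' z * (b - a)"
  proof (rule mvt_simple[OF \<open>a < b\<close>])
    fix x assume "a \<le> x" "x \<le> b"
    then have "x \<in> S" using sub by auto
    from has_field_derivative_subset[OF f[OF this] sub]
    show "(f has_derivative (\<lambda>d. f' x * d)) (at x within {a..b})"
      by (simp only: has_field_derivative_def)
  qed
  then obtain z where z: "z \<in> {a<..<b}" "f b - f a = f' z * (b - a)"
    by blast
  moreover have "f' z > 0"
    by (rule pos) (use z(1) sub in auto)
  ultimately have "f b - f a > 0"
    using ab by simp
  then show "f a < f b" by simp
qed

section \<open>The noise density near its upper endpoint\<close>

lemma H2_density_near_1:
  assumes "H2 \<nu> p k"
  obtains b B e where "b > 0" "B > 0" "0 < e" "e < 1"
    "\<And>w. w \<in> {1 - e..1} \<Longrightarrow> b * (1 - w) ^ k \<le> p w \<and> p w \<le> B * (1 - w) ^ k"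
proof -
  obtain \<beta> where \<beta>: "\<beta> > 0"
    and o: "(\<lambda>w. p w - \<beta> * (1 - w) ^ k) \<in> o[at_left 1](\<lambda>w. (1 - w) ^ k)"
    and cont: "continuous_on \<Delta> p"
    using assms Ck_on_imp_continuous_on unfolding H2_def by blast
  have "eventually (\<lambda>w. norm (p w - \<beta> * (1 - w) ^ k) \<le> \<beta> / 2 * norm ((1 - w) ^ k)) (at_left 1)"
    using landau_o.smallD[OF o, of "\<beta> / 2"] \<beta> by simp
  then obtain a where a: "a < 1"
    and bnd: "\<And>w. a < w \<Longrightarrow> w < 1 \<Longrightarrow> norm (p w - \<beta> * (1 - w) ^ k) \<le> \<beta> / 2 * norm ((1 - w) ^ k)"
    unfolding eventually_at_left[OF zero_less_one] by blast
  have near: "\<beta> / 2 * (1 - w) ^ k \<le> p w \<and> p w \<le> 3 * \<beta> / 2 * (1 - w) ^ k" if "a < w" "w < 1" for w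
  proof -
    have "\<bar>p w - \<beta> * (1 - w) ^ k\<bar> \<le> \<beta> / 2 * (1 - w) ^ k"
      using bnd[OF that] that by simp
    then show ?thesis by linarith
  qed
  have ev: "eventually (\<lambda>w. a < w \<and> w < 1) (at_left 1)"
    unfolding eventually_at_left[OF zero_less_one] using a by auto
  have "(p \<longlongrightarrow> p 1) (at 1 within \<Delta>)"
    using cont by (auto simp: continuous_on_def)
  then have lim: "(p \<longlongrightarrow> p 1) (at_left 1)"
    using at_within_Icc_at_left[of "-1" "1::real"] by simp
  have lim': "((\<lambda>w. c * (1 - w) ^ k) \<longlongrightarrow> c * (1 - 1) ^ k) (at_left 1)" for c :: real
    by (intro tendsto_intros)
  \<comment> \<open>The little-o condition along \<open>at_left 1\<close> is silent at
    \<open>w = 1\<close> itself; continuity of \<open>p\<close> carries both inequalities to the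
    endpoint. For \<open>k = 0\<close> the power there is 1, not 0.\<close>
  have at_1: "\<beta> / 2 * (1 - 1) ^ k \<le> p 1 \<and> p 1 \<le> 3 * \<beta> / 2 * (1 - 1) ^ k"
  proof
    show "\<beta> / 2 * (1 - 1) ^ k \<le> p 1"
      by (rule tendsto_le[OF _ lim lim']) (use eventually_mono[OF ev] near in auto)
    show "p 1 \<le> 3 * \<beta> / 2 * (1 - 1) ^ k"
      by (rule tendsto_le[OF _ lim' lim]) (use eventually_mono[OF ev] near in auto)
  qed
  \<comment> \<open>Halving \<open>1 - a\<close> makes \<open>1 - e\<close> strictly larger than
    \<open>a\<close>; the cap \<open>1/2\<close> gives \<open>e < 1\<close>.\<close>
  define e where "e = min (1/2) ((1 - a) / 2)"
  have "\<beta> / 2 * (1 - w) ^ k \<le> p w \<and> p w \<le> 3 * \<beta> / 2 * (1 - w) ^ k" if "w \<in> {1 - e..1}" for w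
  proof (cases "w = 1")
    case True
    then show ?thesis using at_1 by simp
  next
    case False
    have "e \<le> (1 - a) / 2"
      unfolding e_def by (rule min.cobounded2)
    moreover have "w \<ge> 1 - e" "w < 1"
      using that False by auto
    ultimately have "a < w" using a by (simp add: field_simps)
    then show ?thesis using near \<open>w < 1\<close> by blast
  qed
  moreover have "0 < e" "e < 1"
    using a by (auto simp: e_def)
  ultimately show thesis
    using that[of "\<beta> / 2" "3 * \<beta> / 2" e] \<beta> by auto
qed

section \<open>Difference inequalities with step L\<close>

text \<open>Finitely many shifts by \<open>L\<close> bring any \<open>u\<close> back into the window
  of length \<open>L\<close> where \<open>g\<close> is bounded. The induction counts windows, so no
  continuity of \<open>g\<close> is involved.\<close>

lemma bounded_if_nonincreasing_shift:
  fixes g :: "real \<Rightarrow> real"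
  assumes "L > 0"
    and bnd: "\<And>u. u \<in> {u0 - L..u0} \<Longrightarrow> g u \<le> K"
    and shift: "\<And>u. u \<ge> u0 \<Longrightarrow> g u \<le> g (u - L)"
    and "u \<ge> u0 - L"
  shows "g u \<le> K"
proof -
  have "\<forall>u. u0 - L \<le> u \<and> u \<le> u0 + real n * L \<longrightarrow> g u \<le> K" for n
  proof (induction n)
    case 0
    then show ?case using bnd by auto
  next
    case (Suc n)
    show ?case
    proof (intro allI impI)
      fix u assume u: "u0 - L \<le> u \<and> u \<le> u0 + real (Suc n) * L"
      show "g u \<le> K"
      proof (cases "u \<le> u0")
        case False
        then have "g (u - L) \<le> K"
          using Suc u by (auto simp: algebra_simps)
        then show ?thesis using shift[of u] False by linarith
      qed (use bnd u in auto)
    qed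
  qed
  moreover obtain n where "(u - u0) / L \<le> real n"
    using real_arch_simple by blast
  then have "u \<le> u0 + real n * L"
    using \<open>L > 0\<close> by (simp add: field_simps)
  ultimately show ?thesis using assms(4) by blast
qed

text \<open>The comparison function \<open>Q\<close> is the quadratic polynomial with \<open>Q u - Q (u - L) = c - m * u\<close>.\<close>

lemma quadratic_growth_recursion:
  fixes a v :: "real \<Rightarrow> real"
  assumes "L > 0"
    and bnd: "\<And>u. u \<in> {u0 - L..u0} \<Longrightarrow> a u \<le> K"
    and rec: "\<And>u. u \<ge> u0 \<Longrightarrow> a u \<le> c - m * u + a (u - L)"
    and v: "\<And>u. u \<ge> u0 \<Longrightarrow> v u \<le> c' - m' * u + a (u - L)"
    and e: "- m / (2 * L) < e"
  shows "eventually (\<lambda>u. v u / u\<^sup>2 < e) at_top"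
proof -
  \<comment> \<open>The drift \<open>- m * u\<close> forces the leading coefficient
    \<open>- m / (2 * L)\<close> of \<open>Q\<close>; matching constant terms then requires
    \<open>d * L + m * L / 2 = c\<close>.\<close>
  define d where "d = c / L - m / 2"
  define Q where "Q = (\<lambda>u. d * u - m / (2 * L) * u\<^sup>2)"
  have Q_shift: "Q u - Q (u - L) = c - m * u" for u
    using \<open>L > 0\<close> by (simp add: Q_def d_def field_simps power2_eq_square)
  have "continuous_on {u0 - L..u0} Q"
    unfolding Q_def by (intro continuous_intros)
  then have "\<exists>z\<in>{u0 - L..u0}. \<forall>u\<in>{u0 - L..u0}. Q z \<le> Q u"
    using \<open>L > 0\<close> by (intro continuous_attains_inf) auto
  then obtain z where z: "\<And>u. u \<in> {u0 - L..u0} \<Longrightarrow> Q z \<le> Q u"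
    by blast
  have le: "a u - Q u \<le> K - Q z" if "u \<ge> u0 - L" for u
  proof (rule bounded_if_nonincreasing_shift[OF \<open>L > 0\<close> _ _ that])
    show "a u - Q u \<le> K - Q z" if "u \<in> {u0 - L..u0}" for u
      using bnd z that by (smt (verit))
    show "a u - Q u \<le> a (u - L) - Q (u - L)" if "u \<ge> u0" for u
      using rec[OF that] Q_shift[of u] by linarith
  qed
  \<comment> \<open>For \<open>u \<ge> u0\<close> the shifted argument \<open>u - L\<close> is still
    in the range \<open>\<ge> u0 - L\<close> of the bound on \<open>a\<close>. The terms with
    \<open>c'\<close> and \<open>m'\<close> are at most linear in \<open>u\<close>, so
    \<open>v\<close> inherits the quadratic rate of \<open>a\<close> whatever \<open>m'\<close> is;
    this is how exponent \<open>k\<close> for the density and \<open>k + 1\<close> for the tail lead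
    to the same limit.\<close>
  define R where "R = (\<lambda>u. c' - m' * u + Q (u - L) + (K - Q z))"
  have "((\<lambda>u. R u / u\<^sup>2) \<longlongrightarrow> - m / (2 * L)) at_top"
    unfolding R_def Q_def using \<open>L > 0\<close> by real_asymp
  then have "eventually (\<lambda>u. R u / u\<^sup>2 < e) at_top"
    using e by (simp add: order_tendstoD)
  moreover have "eventually (\<lambda>u. v u / u\<^sup>2 \<le> R u / u\<^sup>2) at_top"
    using eventually_ge_at_top[of u0]
  proof eventually_elim
    case (elim u)
    have "v u \<le> R u"
      using v[OF elim] le[of "u - L"] elim unfolding R_def by linarith
    then show ?case by (simp add: divide_right_mono)
  qed
  ultimately show ?thesis
    by eventually_elim linarith
qed

section \<open>The transition kernel near the upper fixed point\<close>

text \<open>The transition density from \<open>y\<close> to \<open>x\<close>, that is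
  \<open>p\<close> transported by \<open>h y\<close>. It is meaningful only for \<open>x\<close> in
  the image of \<open>h y\<close>, to which the fixed point equation restricts the integral.\<close>

definition noise_kernel :: "(real \<Rightarrow> real \<Rightarrow> real) \<Rightarrow> (real \<Rightarrow> real) \<Rightarrow> real \<Rightarrow> real \<Rightarrow> real" where
  "noise_kernel h p x y =
     (let w = the_inv_into \<Delta> (h y) x in p w / partial_noise h y w)"

text \<open>Near \<open>(xp, 1)\<close> the noise derivative stays between \<open>c / 2\<close> and
  \<open>3 * c / 2\<close>, so \<open>h y 1 - x\<close> is comparable to \<open>1 - w\<close> by the
  mean value theorem, and (H2) converts this into the power \<open>k\<close>. The conclusion
  \<open>h y (-1) \<le> x\<close> disposes of the lower constraint on the domain of
  integration.\<close>

lemma noise_kernel_bounds: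
  assumes rde: "random_difference_equation X h \<nu>" and H1: "H1 X h" and H2: "H2 \<nu> p k"
    and xp: "xp \<in> X" "h xp 1 = xp"
  obtains b B d where "b > 0" "B > 0" "d > 0"
    "\<And>x y. y \<in> X \<Longrightarrow> \<bar>y - xp\<bar> < d \<Longrightarrow> xp - d < x \<Longrightarrow> x \<le> h y 1 \<Longrightarrow>
       h y (-1) \<le> x \<and> b * (h y 1 - x) ^ k \<le> noise_kernel h p x y \<and>
       noise_kernel h p x y \<le> B * (h y 1 - x) ^ k"
proof -
  have "continuously_differentiable_on (\<lambda>(x, w). h x w) (X \<times> \<Delta>)"
    using rde by (simp add: random_difference_equation_def)
  then obtain Dw Dx :: "real \<times> real \<Rightarrow> real" where
    contD: "continuous_on (X \<times> \<Delta>) Dw"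
    and Dx: "\<And>x w. x \<in> X \<Longrightarrow> w \<in> \<Delta> \<Longrightarrow> ((\<lambda>x. h x w) has_real_derivative Dx (x, w)) (at x within X)"
    and Dw: "\<And>x w. x \<in> X \<Longrightarrow> w \<in> \<Delta> \<Longrightarrow> (h x has_real_derivative Dw (x, w)) (at w within \<Delta>)"
    by (rule continuously_differentiable_on_partials) blast
  have noise: "partial_noise h y w = Dw (y, w)" if "y \<in> X" "w \<in> \<Delta>" for y w
    unfolding partial_noise_def
    by (rule vector_derivative_within_interval[OF _ that(2), where y = "if w = 1 then -1 else 1"])
       (use that Dw in \<open>auto simp: is_interval_cc\<close>)
  have pos: "Dw (y, w) > 0" if "y \<in> X" "w \<in> \<Delta>" for y w
  proof -
    have "partial_noise h y w > 0"
      using H1 that unfolding H1_def by blast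
    then show ?thesis using noise[OF that] by simp
  qed
  have mono: "strict_mono_on \<Delta> (h y)" if "y \<in> X" for y
    by (rule strict_mono_on_interval_if_derivative_pos[OF is_interval_cc Dw[OF that] pos[OF that]])
  have cont: "continuous_on \<Delta> (h y)" if "y \<in> X" for y
    using DERIV_continuous[OF Dw[OF that]] by (simp add: continuous_on_eq_continuous_within)
  define c where "c = Dw (xp, 1)"
  have "c > 0"
    using pos xp by (simp add: c_def)
  obtain \<delta> where \<delta>: "\<delta> > 0"
    "\<And>z. z \<in> X \<times> \<Delta> \<Longrightarrow> dist z (xp, 1) < \<delta> \<Longrightarrow> dist (Dw z) c < c / 2"
    using contD[unfolded continuous_on_iff, rule_format, of "(xp, 1)" "c / 2"] xp \<open>c > 0\<close>
    by (auto simp: c_def)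
  obtain b0 B0 e where p: "b0 > 0" "B0 > 0" "0 < e" "e < 1"
    "\<And>w. w \<in> {1 - e..1} \<Longrightarrow> b0 * (1 - w) ^ k \<le> p w \<and> p w \<le> B0 * (1 - w) ^ k"
    using H2_density_near_1[OF H2] by blast
  define e' where "e' = min e (\<delta> / 2)"
  have e': "0 < e'" "e' \<le> e" "e' \<le> \<delta> / 2" "e' < 1"
    using p \<delta> by (auto simp: e'_def)
  \<comment> \<open>On noise values in \<open>{w0..1}\<close> the estimate of \<open>p\<close> and,
    for \<open>y\<close> close to \<open>xp\<close>, that of \<open>Dw\<close> are both valid. It
    remains to force the noise leading from \<open>y\<close> to \<open>x\<close> into this
    range.\<close>
  define w0 where "w0 = 1 - e'"
  have w0: "w0 \<in> \<Delta>" "w0 < 1"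
    using e' by (auto simp: w0_def)
  \<comment> \<open>The midpoint of \<open>h xp w0\<close> and \<open>xp\<close> serves as a
    barrier: \<open>h y w0\<close> stays below it for \<open>y\<close> near \<open>xp\<close> by
    continuity, and \<open>x\<close> stays above it once \<open>d\<close> is at most half the
    gap.\<close>
  have gap: "h xp w0 < xp"
    using strict_mono_onD[OF mono[OF xp(1)] w0(1) _ w0(2)] xp by simp
  have "continuous (at xp within X) (\<lambda>x. h x w0)"
    by (rule DERIV_continuous[OF Dx[OF xp(1) w0(1)]])
  then have "eventually (\<lambda>y. h y w0 < (xp + h xp w0) / 2) (at xp within X)"
    using gap by (intro order_tendstoD(2)[of _ "h xp w0"]) (auto simp: continuous_within)
  then obtain d2 where d2: "d2 > 0"
    "\<And>y. y \<in> X \<Longrightarrow> y \<noteq> xp \<Longrightarrow> dist y xp < d2 \<Longrightarrow> h y w0 < (xp + h xp w0) / 2"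
    unfolding eventually_at by blast
  define d where "d = min (\<delta> / 2) (min d2 ((xp - h xp w0) / 2))"
  have d: "d > 0" "d \<le> \<delta> / 2" "d \<le> d2" "d \<le> (xp - h xp w0) / 2"
    using \<delta> d2 gap unfolding d_def
    by (simp, meson min.cobounded1 min.cobounded2 order_trans, meson min.cobounded1 min.cobounded2 order_trans,
        meson min.cobounded1 min.cobounded2 order_trans)
  show thesis
  proof (rule that)
    show "b0 * (2 / (3 * c)) ^ k * (2 / (3 * c)) > 0" "B0 * (2 / c) ^ k * (2 / c) > 0" "d > 0"
      using p \<open>c > 0\<close> d by auto
  next
    fix x y assume y: "y \<in> X" "\<bar>y - xp\<bar> < d" and x: "xp - d < x" "x \<le> h y 1"
    have Dw_near: "c / 2 \<le> Dw (y, w) \<and> Dw (y, w) \<le> 3 * c / 2" if "w \<in> {w0..1}" for w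
    proof -
      have "\<bar>w - 1\<bar> \<le> \<delta> / 2" "\<bar>y - xp\<bar> < \<delta> / 2"
        using that e' d y by (auto simp: w0_def)
      then have "\<bar>y - xp\<bar> + \<bar>w - 1\<bar> < \<delta>" by (simp add: field_simps)
      then have "dist (y, w) (xp, 1) < \<delta>"
        using sqrt_sum_squares_le_sum_abs[of "y - xp" "w - 1"]
        by (simp add: dist_Pair_Pair dist_real_def)
      moreover have "w \<in> \<Delta>" using that w0 by auto
      ultimately have "\<bar>Dw (y, w) - c\<bar> < c / 2"
        using \<delta>(2)[of "(y, w)"] y by (simp add: dist_real_def)
      then show ?thesis by linarith
    qed
    have "h y w0 < (xp + h xp w0) / 2"
      using d2(2)[of y] y d gap by (cases "y = xp") (auto simp: dist_real_def)
    moreover have "(xp + h xp w0) / 2 = xp - (xp - h xp w0) / 2"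
      by (simp add: field_simps)
    ultimately have low: "h y w0 < x"
      using x d by linarith
    have "continuous_on {w0..1} (h y)"
      using cont[OF y(1)] by (rule continuous_on_subset) (use w0 in auto)
    then obtain w where w: "w \<in> {w0..1}" "h y w = x"
      using IVT'[of "h y" w0 x 1] low x w0 by auto
    then have w\<Delta>: "w \<in> \<Delta>" using w0 by auto
    have inv: "the_inv_into \<Delta> (h y) x = w"
      using the_inv_into_f_f[OF strict_mono_on_imp_inj_on[OF mono[OF y(1)]] w\<Delta>] w by simp
    have lin: "c / 2 * (1 - w) \<le> h y 1 - x \<and> h y 1 - x \<le> 3 * c / 2 * (1 - w)"
    proof (cases "w = 1")
      case False
      then have "w < 1" using w by auto
      have "\<exists>v\<in>{w<..<1}. h y 1 - h y w = Dw (y, v) * (1 - w)"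
      proof (rule mvt_simple[OF \<open>w < 1\<close>])
        fix v assume "w \<le> v" "v \<le> 1"
        then have v: "v \<in> \<Delta>" using w\<Delta> by auto
        have "(h y has_real_derivative Dw (y, v)) (at v within {w..1})"
          by (rule has_field_derivative_subset[OF Dw[OF y(1) v]]) (use w\<Delta> in auto)
        then show "(h y has_derivative (\<lambda>d. Dw (y, v) * d)) (at v within {w..1})"
          by (simp only: has_field_derivative_def)
      qed
      then obtain v where v: "v \<in> {w<..<1}" "h y 1 - x = Dw (y, v) * (1 - w)"
        using w by blast
      have "c / 2 \<le> Dw (y, v)" "Dw (y, v) \<le> 3 * c / 2"
        using Dw_near[of v] v(1) w(1) by auto
      then show ?thesis
        unfolding v(2) using \<open>w < 1\<close> by (auto intro!: mult_right_mono)
    qed (use w in auto)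
    have "0 \<le> 1 - w" using w by auto
    have lin': "2 / (3 * c) * (h y 1 - x) \<le> 1 - w" "1 - w \<le> 2 / c * (h y 1 - x)"
      using lin \<open>c > 0\<close> by (auto simp: field_simps)
    have pw: "b0 * (1 - w) ^ k \<le> p w" "p w \<le> B0 * (1 - w) ^ k"
      using p(5)[of w] w e' by (auto simp: w0_def)
    have Dwp: "c / 2 \<le> Dw (y, w)" "Dw (y, w) \<le> 3 * c / 2"
      using Dw_near[OF w(1)] by auto
    have K: "noise_kernel h p x y = p w / Dw (y, w)"
      using noise[OF y(1) w\<Delta>] by (simp add: noise_kernel_def inv)
    have "b0 * (2 / (3 * c)) ^ k * (2 / (3 * c)) * (h y 1 - x) ^ k
        = b0 * (2 / (3 * c) * (h y 1 - x)) ^ k / (3 * c / 2)"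
      unfolding power_mult_distrib by (simp add: ac_simps)
    also have "\<dots> \<le> b0 * (1 - w) ^ k / (3 * c / 2)"
      using lin' p(1) \<open>c > 0\<close> x
      by (intro divide_right_mono mult_left_mono power_mono) auto
    also have "\<dots> \<le> p w / Dw (y, w)"
      by (rule frac_le) (use pw Dwp p(1) \<open>c > 0\<close> \<open>0 \<le> 1 - w\<close> order_trans[OF _ pw(1)] in auto)
    finally have lower: "b0 * (2 / (3 * c)) ^ k * (2 / (3 * c)) * (h y 1 - x) ^ k \<le> noise_kernel h p x y"
      unfolding K .
    have "p w / Dw (y, w) \<le> B0 * (1 - w) ^ k / (c / 2)"
      by (rule frac_le) (use pw Dwp p(2) \<open>c > 0\<close> \<open>0 \<le> 1 - w\<close> in auto)
    also have "\<dots> \<le> B0 * (2 / c * (h y 1 - x)) ^ k / (c / 2)"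
      using lin' p(2) \<open>c > 0\<close> \<open>0 \<le> 1 - w\<close>
      by (intro divide_right_mono mult_left_mono power_mono) auto
    also have "\<dots> = B0 * (2 / c) ^ k * (2 / c) * (h y 1 - x) ^ k"
      unfolding power_mult_distrib by (simp add: ac_simps)
    finally have upper: "noise_kernel h p x y \<le> B0 * (2 / c) ^ k * (2 / c) * (h y 1 - x) ^ k"
      unfolding K .
    have "h y (-1) \<le> h y w0"
      using strict_mono_on_leD[OF mono[OF y(1)], of "-1" w0] w0 by auto
    then show "h y (-1) \<le> x \<and>
       b0 * (2 / (3 * c)) ^ k * (2 / (3 * c)) * (h y 1 - x) ^ k \<le> noise_kernel h p x y \<and>
       noise_kernel h p x y \<le> B0 * (2 / c) ^ k * (2 / c) * (h y 1 - x) ^ k"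
      using low lower upper by simp
  qed
qed

section \<open>Tail mass of the stationary distribution\<close>

locale stationary_setting =
  fixes X M :: "real set"
    and h :: "real \<Rightarrow> real \<Rightarrow> real"
    and \<nu> \<mu> :: "real measure"
    and p \<phi> :: "real \<Rightarrow> real"
    and k :: nat
    and xp lam :: real
  assumes rde: "random_difference_equation X h \<nu>"
    and H1: "H1 X h"
    and H2: "H2 \<nu> p k"
    and prob: "prob_space \<mu>"
    and M_interval: "is_interval M"
    and M_subset: "M \<subseteq> X"
    and M_support: "M = measure_support \<mu>"
    and density: "stationary_density X h p \<mu> M \<phi>"
    and M_bdd: "bdd_above M"
    and xp_eq: "xp = Sup M"
    and xp_in: "xp \<in> X"
    and xp_fixed: "h xp 1 = xp"
    and lam: "0 < lam" "lam < 1"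
    and linearization: "(\<lambda>x. upper_map h x - (xp + lam * (x - xp))) \<in> o[at xp within X](\<lambda>x. xp - x)"
begin

text \<open>Kept in \<open>ennreal\<close> so that it can be compared directly with the right-hand
  side of the fixed point equation, without integrability conditions. The indicator of
  \<open>M\<close> is included because \<open>\<phi>\<close> is arbitrary outside
  \<open>M\<close>.\<close>

definition nn_tail :: "real \<Rightarrow> ennreal" where
  "nn_tail t = (\<integral>\<^sup>+y. ennreal (\<phi> y) * indicator (M \<inter> {xp - t..}) y \<partial>lborel)"

definition tail_mass :: "real \<Rightarrow> real" where
  "tail_mass t = enn2real (nn_tail t)"

lemma X_interval: "is_interval X"
  using rde by (simp add: random_difference_equation_def)

lemma M_le: "y \<in> M \<Longrightarrow> y \<le> xp"
  using M_bdd by (simp add: xp_eq cSup_upper)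

lemma M_borel [measurable]: "M \<in> sets borel"
  by (rule real_interval_borel_measurable[OF M_interval])

lemma density_measurable [measurable]: "(\<lambda>y. ennreal (\<phi> y) * indicator M y) \<in> borel_measurable borel"
proof -
  have "\<phi> \<in> borel_measurable (restrict_space borel M)"
    using density by (simp add: stationary_density_def)
  then have "(\<lambda>y. indicator M y *\<^sub>R \<phi> y) \<in> borel_measurable borel"
    by (subst (asm) borel_measurable_restrict_space_iff) auto
  then have "(\<lambda>y. ennreal (indicator M y *\<^sub>R \<phi> y)) \<in> borel_measurable borel"
    by measurable
  moreover have "(\<lambda>y. ennreal (indicator M y *\<^sub>R \<phi> y)) = (\<lambda>y. ennreal (\<phi> y) * indicator M y)"
    by (auto simp: indicator_def)
  ultimately show ?thesis by simp
qed

lemma nn_tail_measurable: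
  "(\<lambda>y. ennreal (\<phi> y) * indicator (M \<inter> {xp - t..}) y) \<in> borel_measurable borel"
proof -
  have "(\<lambda>y. ennreal (\<phi> y) * indicator M y * indicator {xp - t..} y) \<in> borel_measurable borel"
    by measurable
  then show ?thesis by (simp add: indicator_inter_arith mult.assoc)
qed

lemma space_\<mu>: "space \<mu> = X"
  using density by (simp add: stationary_density_def space_restrict_space)

lemma emeasure_\<mu>:
  assumes "A \<in> sets borel"
  shows "emeasure \<mu> (A \<inter> X) = (\<integral>\<^sup>+y. ennreal (\<phi> y) * indicator (M \<inter> A) y \<partial>lborel)"
proof -
  have X: "X \<in> sets borel"
    by (rule real_interval_borel_measurable[OF X_interval])
  have "\<mu> = density (restrict_space lborel X) (\<lambda>x. ennreal (\<phi> x) * indicator M x)"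
    using density by (simp add: stationary_density_def)
  then have "emeasure \<mu> (A \<inter> X) =
      (\<integral>\<^sup>+y. (ennreal (\<phi> y) * indicator M y) * indicator (A \<inter> X) y \<partial>restrict_space lborel X)"
    using assms X
    by (simp add: emeasure_density measurable_restrict_space1 sets_restrict_space_iff)
  also have "\<dots> = (\<integral>\<^sup>+y. (ennreal (\<phi> y) * indicator M y) * indicator (A \<inter> X) y * indicator X y \<partial>lborel)"
    using X by (intro nn_integral_restrict_space) simp
  also have "\<dots> = (\<integral>\<^sup>+y. ennreal (\<phi> y) * indicator (M \<inter> A) y \<partial>lborel)"
    using M_subset by (intro nn_integral_cong) (auto simp: indicator_def)
  finally show ?thesis .
qed

lemma nn_tail_le_1: "nn_tail t \<le> 1"
proof -
  have "nn_tail t = emeasure \<mu> ({xp - t..} \<inter> X)"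
    unfolding nn_tail_def by (rule emeasure_\<mu>[symmetric]) simp
  then show ?thesis using prob_space.emeasure_le_1[OF prob] by simp
qed

lemma nn_tail_eq: "nn_tail t = ennreal (tail_mass t)"
  using nn_tail_le_1[of t] unfolding tail_mass_def by (metis ennreal_enn2real ennreal_one_less_top le_less_trans)

lemma tail_mass_nonneg: "0 \<le> tail_mass t"
  by (simp add: tail_mass_def)

lemma tail_mass_le_1: "tail_mass t \<le> 1"
  using nn_tail_le_1[of t] by (simp add: nn_tail_eq)

lemma tail_mass_mono: "s \<le> t \<Longrightarrow> tail_mass s \<le> tail_mass t"
proof -
  assume "s \<le> t"
  then have "nn_tail s \<le> nn_tail t"
    unfolding nn_tail_def by (intro nn_integral_mono) (auto simp: indicator_def)
  then show ?thesis by (simp add: nn_tail_eq tail_mass_nonneg)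
qed

text \<open>Otherwise the density would live on the Lebesgue null set \<open>{xp}\<close>,
  contradicting total mass 1.\<close>

lemma ex_below_xp: "\<exists>z\<in>M. z < xp"
proof (rule ccontr)
  assume "\<not> ?thesis"
  then have "M \<subseteq> {xp}" using M_le by force
  have "emeasure \<mu> (UNIV \<inter> X) = 1"
    using prob_space.emeasure_space_1[OF prob] by (simp add: space_\<mu>)
  then have "(\<integral>\<^sup>+y. ennreal (\<phi> y) * indicator (M \<inter> UNIV) y \<partial>lborel) = 1"
    by (subst (asm) emeasure_\<mu>) auto
  moreover have "(\<integral>\<^sup>+y. ennreal (\<phi> y) * indicator (M \<inter> UNIV) y \<partial>lborel)
      \<le> (\<integral>\<^sup>+y. ennreal (\<phi> xp) * indicator {xp} y \<partial>lborel)"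
    by (intro nn_integral_mono) (use \<open>M \<subseteq> {xp}\<close> in \<open>auto simp: indicator_def\<close>)
  moreover have "(\<integral>\<^sup>+y. ennreal (\<phi> xp) * indicator {xp} y \<partial>lborel) = 0"
    by (simp add: nn_integral_cmult_indicator)
  ultimately show False by simp
qed

lemma in_M:
  assumes "z \<in> M" "z \<le> x" "x < xp"
  shows "x \<in> M"
proof -
  obtain y where "y \<in> M" "x < y"
    using assms less_cSupD[of M x] xp_eq by auto
  then show ?thesis
    using mem_is_interval_1_I[OF M_interval, of z y x] assms by simp
qed

text \<open>Every open neighbourhood of a support point is charged. Positivity is what makes
  \<open>ln (tail_mass t)\<close> meaningful.\<close>

lemma tail_mass_pos:
  assumes "t > 0"
  shows "tail_mass t > 0"
proof -
  obtain z where "z \<in> M" "z < xp"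
    using ex_below_xp by blast
  \<comment> \<open>The maximum with \<open>z\<close> keeps \<open>v\<close> in \<open>M\<close>,
    and \<open>t / 2\<close> instead of \<open>t\<close> keeps it inside the open ray above
    \<open>xp - t\<close>.\<close>
  define v where "v = max z (xp - t / 2)"
  have "v \<in> M"
    using \<open>z \<in> M\<close> by (rule in_M) (simp_all add: v_def assms \<open>z < xp\<close>)
  then have "v \<in> measure_support \<mu>"
    using M_support by simp
  then have "\<And>U. open U \<Longrightarrow> v \<in> U \<Longrightarrow> emeasure \<mu> (U \<inter> X) > 0"
    unfolding measure_support_def space_\<mu> by simp
  moreover have "v \<in> {xp - t<..}"
    using assms by (simp add: v_def less_max_iff_disj)
  ultimately have "emeasure \<mu> ({xp - t<..} \<inter> X) > 0"
    using open_greaterThan by blast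
  then have "0 < (\<integral>\<^sup>+y. ennreal (\<phi> y) * indicator (M \<inter> {xp - t<..}) y \<partial>lborel)"
    by (simp add: emeasure_\<mu>)
  also have "\<dots> \<le> nn_tail t"
    unfolding nn_tail_def by (intro nn_integral_mono) (auto simp: indicator_def)
  finally show ?thesis by (simp add: nn_tail_eq)
qed

lemma \<phi>_nonneg: "x \<in> M \<Longrightarrow> 0 \<le> \<phi> x"
  using density by (simp add: stationary_density_def)

lemma \<phi>_eq:
  assumes "x \<in> M"
  shows "ennreal (\<phi> x) =
    (\<integral>\<^sup>+y. ennreal (noise_kernel h p x y * \<phi> y) *
       indicator {y\<in>M. h y (-1) \<le> x \<and> x \<le> h y 1} y \<partial>lborel)"
  using density assms
  by (simp add: stationary_density_def noise_kernel_def Let_def lower_map_def upper_map_def)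

section \<open>Bounding the density by the tail mass\<close>

lemma upper_map_mono:
  assumes "x \<in> X" "y \<in> X" "x < y"
  shows "h x 1 < h y 1"
proof -
  obtain Dw Dx :: "real \<times> real \<Rightarrow> real" where
    Dx: "\<And>x w. x \<in> X \<Longrightarrow> w \<in> \<Delta> \<Longrightarrow> ((\<lambda>x. h x w) has_real_derivative Dx (x, w)) (at x within X)"
  proof (rule continuously_differentiable_on_partials)
    show "continuously_differentiable_on (\<lambda>(x, w). h x w) (X \<times> \<Delta>)"
      using rde by (simp add: random_difference_equation_def)
  qed blast
  have one: "(1::real) \<in> \<Delta>" by simp
  have pos: "Dx (z, 1) > 0" if "z \<in> X" for z
  proof -
    have "\<exists>z'\<in>X. z \<noteq> z'" using assms by (metis less_irrefl)
    then have "partial_x X h z 1 = Dx (z, 1)"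
      unfolding partial_x_def
      using vector_derivative_within_interval[OF X_interval that _ _ Dx[OF that one]] by blast
    moreover have "partial_x X h z 1 > 0"
      using H1 that one unfolding H1_def by blast
    ultimately show ?thesis by simp
  qed
  have "strict_mono_on X (\<lambda>x. h x 1)"
    by (rule strict_mono_on_interval_if_derivative_pos[OF X_interval Dx[OF _ one] pos])
  from strict_mono_onD[OF this assms] show ?thesis .
qed

lemma upper_map_near_xp:
  assumes "e > 0"
  obtains d where "d > 0"
    "\<And>y. y \<in> X \<Longrightarrow> xp - d < y \<Longrightarrow> y \<le> xp \<Longrightarrow>
      (lam - e) * (xp - y) \<le> xp - h y 1 \<and> xp - h y 1 \<le> (lam + e) * (xp - y)"
proof -
  have "eventually (\<lambda>y. norm (h y 1 - (xp + lam * (y - xp))) \<le> e * norm (xp - y)) (at xp within X)"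
    using landau_o.smallD[OF linearization assms] by (simp add: upper_map_def)
  then obtain d where d: "d > 0" "\<And>y. y \<in> X \<Longrightarrow> y \<noteq> xp \<Longrightarrow> dist y xp < d \<Longrightarrow>
      \<bar>h y 1 - (xp + lam * (y - xp))\<bar> \<le> e * \<bar>xp - y\<bar>"
    unfolding eventually_at by auto
  show thesis
  proof (rule that[OF d(1)])
    fix y assume y: "y \<in> X" "xp - d < y" "y \<le> xp"
    have "\<bar>h y 1 - (xp + lam * (y - xp))\<bar> \<le> e * (xp - y)"
    proof (cases "y = xp")
      case False
      then show ?thesis using d(2)[of y] y by (simp add: dist_real_def)
    qed (simp add: xp_fixed)
    then have "h y 1 - (xp + lam * (y - xp)) \<le> e * (xp - y)"
      "- (h y 1 - (xp + lam * (y - xp))) \<le> e * (xp - y)"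
      by linarith+
    then show "(lam - e) * (xp - y) \<le> xp - h y 1 \<and> xp - h y 1 \<le> (lam + e) * (xp - y)"
      by (simp add: algebra_simps)
  qed
qed

text \<open>A state far from \<open>xp\<close> cannot jump close to \<open>xp\<close> in one step:
  once \<open>x\<close> exceeds \<open>h y0 1\<close>, monotonicity leaves only states
  \<open>y > y0\<close>, where the kernel bounds and the linearization both apply. For these,
  \<open>h y 1 \<le> xp\<close> gives \<open>h y 1 - x \<le> t\<close>, and
  \<open>l * (xp - y) \<le> xp - h y 1 \<le> t\<close> places \<open>y\<close> in the tail.\<close>

lemma density_upper_bound:
  assumes l: "0 < l" "l < lam"
  obtains t0 B where "t0 > 0" "B > 0"
    "\<And>t. 0 < t \<Longrightarrow> t \<le> t0 \<Longrightarrow> xp - t \<in> M \<and> \<phi> (xp - t) \<le> B * t ^ k * tail_mass (t / l)"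
proof -
  obtain b B d where "b > 0" "B > 0" "d > 0" and K:
    "\<And>x y. y \<in> X \<Longrightarrow> \<bar>y - xp\<bar> < d \<Longrightarrow> xp - d < x \<Longrightarrow> x \<le> h y 1 \<Longrightarrow>
       h y (-1) \<le> x \<and> b * (h y 1 - x) ^ k \<le> noise_kernel h p x y \<and>
       noise_kernel h p x y \<le> B * (h y 1 - x) ^ k"
    using noise_kernel_bounds[OF rde H1 H2 xp_in xp_fixed] by blast
  obtain d1 where d1: "d1 > 0"
    "\<And>y. y \<in> X \<Longrightarrow> xp - d1 < y \<Longrightarrow> y \<le> xp \<Longrightarrow> l * (xp - y) \<le> xp - h y 1"
    by (rule upper_map_near_xp[of "lam - l"]) (use l in auto)
  obtain z where z: "z \<in> M" "z < xp" using ex_below_xp by blast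
  define y0 where "y0 = max z (max (xp - d / 2) (xp - d1 / 2))"
  have y0: "z \<le> y0" "xp - d < y0" "xp - d1 < y0" "y0 < xp"
    using \<open>d > 0\<close> d1 z by (auto simp: y0_def less_max_iff_disj)
  have y0M: "y0 \<in> M" by (rule in_M[OF z(1)]) (use y0 in auto)
  then have gap: "h y0 1 < xp"
    using upper_map_mono[of y0 xp] y0 xp_in xp_fixed M_subset by auto
  \<comment> \<open>Half of the gap keeps \<open>x = xp - t\<close> strictly above
    \<open>h y0 1\<close>.\<close>
  define t0 where "t0 = min (xp - y0) ((xp - h y0 1) / 2)"
  have t0: "t0 > 0" "t0 \<le> xp - y0" "t0 < xp - h y0 1"
    using y0 gap by (auto simp: t0_def min_less_iff_disj)
  show thesis
  proof (rule that[OF t0(1) \<open>B > 0\<close>])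
    fix t assume t: "0 < t" "t \<le> t0"
    define x where "x = xp - t"
    have x: "x < xp" "y0 \<le> x" "h y0 1 < x" "xp - d < x"
      using t t0 y0 by (auto simp: x_def)
    have xM: "x \<in> M" by (rule in_M[OF y0M]) (use x in auto)
    have near: "noise_kernel h p x y \<le> B * t ^ k \<and> xp - t / l \<le> y"
      if y: "y \<in> M" "x \<le> h y 1" for y
    proof -
      have yX: "y \<in> X" and "y \<le> xp" using y M_subset M_le by auto
      have "y0 < y"
      proof (rule ccontr)
        assume "\<not> y0 < y"
        then have "h y 1 \<le> h y0 1"
          using upper_map_mono[of y y0] yX y0M M_subset by (cases "y = y0") auto
        then show False using x y by linarith
      qed
      have "h y 1 \<le> xp"
        using upper_map_mono[of y xp] yX xp_in xp_fixed \<open>y \<le> xp\<close> by (cases "y = xp") auto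
      have "noise_kernel h p x y \<le> B * (h y 1 - x) ^ k"
        using K[OF yX _ x(4) y(2)] \<open>y0 < y\<close> y0 \<open>y \<le> xp\<close> by auto
      also have "\<dots> \<le> B * t ^ k"
        using \<open>B > 0\<close> \<open>h y 1 \<le> xp\<close> y(2) by (intro mult_left_mono power_mono) (auto simp: x_def)
      finally have "noise_kernel h p x y \<le> B * t ^ k" .
      moreover have "l * (xp - y) \<le> t"
        using d1(2)[OF yX] \<open>y0 < y\<close> y0 \<open>y \<le> xp\<close> y(2) by (auto simp: x_def)
      ultimately show ?thesis using l by (simp add: field_simps)
    qed
    have "ennreal (\<phi> x) \<le> (\<integral>\<^sup>+y. ennreal (B * t ^ k) *
        (ennreal (\<phi> y) * indicator (M \<inter> {xp - t / l..}) y) \<partial>lborel)"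
      unfolding \<phi>_eq[OF xM]
    proof (rule nn_integral_mono)
      fix y
      show "ennreal (noise_kernel h p x y * \<phi> y) * indicator {y \<in> M. h y (-1) \<le> x \<and> x \<le> h y 1} y
        \<le> ennreal (B * t ^ k) * (ennreal (\<phi> y) * indicator (M \<inter> {xp - t / l..}) y)"
      proof (cases "y \<in> M \<and> h y (-1) \<le> x \<and> x \<le> h y 1")
        case True
        have "noise_kernel h p x y * \<phi> y \<le> B * t ^ k * \<phi> y"
          using near[of y] True \<phi>_nonneg by (intro mult_right_mono) auto
        then have "ennreal (noise_kernel h p x y * \<phi> y) \<le> ennreal (B * t ^ k) * ennreal (\<phi> y)"
          using \<open>B > 0\<close> t True \<phi>_nonneg by (simp add: ennreal_mult[symmetric] ennreal_leI)
        then show ?thesis using True near[of y] by (simp add: indicator_def)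
      qed (auto simp: indicator_def)
    qed
    also have "\<dots> = ennreal (B * t ^ k) * nn_tail (t / l)"
      unfolding nn_tail_def using nn_tail_measurable by (intro nn_integral_cmult) simp
    also have "\<dots> = ennreal (B * t ^ k * tail_mass (t / l))"
      using \<open>B > 0\<close> t tail_mass_nonneg by (simp add: nn_tail_eq ennreal_mult)
    finally have "\<phi> x \<le> B * t ^ k * tail_mass (t / l)"
      using \<open>B > 0\<close> t tail_mass_nonneg by (subst (asm) ennreal_le_iff) auto
    then show "xp - t \<in> M \<and> \<phi> (xp - t) \<le> B * t ^ k * tail_mass (t / l)"
      using xM by (simp add: x_def)
  qed
qed

text \<open>On all of \<open>x \<le> h y 1\<close> the kernel has no lower bound of order
  \<open>t ^ k\<close> when \<open>k > 0\<close>. With a rate \<open>l2\<close> strictly between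
  \<open>lam\<close> and \<open>l\<close>, the tail \<open>y \<ge> xp - t / l\<close> stays away
  from the degenerate edge: there \<open>h y 1 - x \<ge> t - l2 * (t / l) = r * t\<close>. Since
  \<open>l\<close> has no upper limit, \<open>l = 1\<close> is allowed, which later yields
  positivity of \<open>\<phi>\<close>.\<close>

lemma density_lower_bound:
  assumes l: "lam < l"
  obtains t0 c where "t0 > 0" "c > 0"
    "\<And>t. 0 < t \<Longrightarrow> t \<le> t0 \<Longrightarrow> xp - t \<in> M \<and> c * t ^ k * tail_mass (t / l) \<le> \<phi> (xp - t)"
proof -
  obtain b B d where "b > 0" "B > 0" "d > 0" and K:
    "\<And>x y. y \<in> X \<Longrightarrow> \<bar>y - xp\<bar> < d \<Longrightarrow> xp - d < x \<Longrightarrow> x \<le> h y 1 \<Longrightarrow>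
       h y (-1) \<le> x \<and> b * (h y 1 - x) ^ k \<le> noise_kernel h p x y \<and>
       noise_kernel h p x y \<le> B * (h y 1 - x) ^ k"
    using noise_kernel_bounds[OF rde H1 H2 xp_in xp_fixed] by blast
  define l2 where "l2 = lam + (l - lam) / 2"
  have l2: "lam < l2" "l2 < l" "0 < l"
    using l lam by (auto simp: l2_def field_simps)
  obtain d1 where d1: "d1 > 0"
    "\<And>y. y \<in> X \<Longrightarrow> xp - d1 < y \<Longrightarrow> y \<le> xp \<Longrightarrow> xp - h y 1 \<le> l2 * (xp - y)"
    by (rule upper_map_near_xp[of "(l - lam) / 2"]) (use l in \<open>auto simp: l2_def\<close>)
  obtain z where z: "z \<in> M" "z < xp" using ex_below_xp by blast
  define r where "r = 1 - l2 / l"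
  have "r > 0" using l2 by (simp add: r_def)
  \<comment> \<open>The first two entries put \<open>x\<close> into \<open>M\<close> and within
    \<open>d\<close> of \<open>xp\<close>; the entries scaled by \<open>l\<close> do the same for
    every \<open>y\<close> with \<open>xp - y \<le> t / l\<close>, relative to \<open>d\<close> and
    \<open>d1\<close>.\<close>
  define t0 where "t0 = Min {xp - z, d / 2, l * (d / 2), l * (d1 / 2)}"
  have t0: "t0 > 0"
    using \<open>d > 0\<close> d1 z l2 by (simp add: t0_def)
  have t0_le: "t0 \<le> xp - z" "t0 \<le> d / 2" "t0 \<le> l * (d / 2)" "t0 \<le> l * (d1 / 2)"
    unfolding t0_def by (rule Min_le; simp)+
  show thesis
  proof (rule that[OF t0])
    show "b * r ^ k > 0" using \<open>b > 0\<close> \<open>r > 0\<close> by simp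
  next
    fix t assume t: "0 < t" "t \<le> t0"
    define x where "x = xp - t"
    have x: "x < xp" "z \<le> x" "xp - d < x"
      using t t0_le \<open>d > 0\<close> by (auto simp: x_def)
    have xM: "x \<in> M" by (rule in_M[OF z(1)]) (use x in auto)
    have near: "b * r ^ k * t ^ k \<le> noise_kernel h p x y \<and> h y (-1) \<le> x \<and> x \<le> h y 1"
      if y: "y \<in> M" "xp - t / l \<le> y" for y
    proof -
      have yX: "y \<in> X" and "y \<le> xp" using y M_subset M_le by auto
      have "t / l \<le> d / 2" "t / l \<le> d1 / 2"
        using t t0_le l2 by (auto simp: divide_le_eq mult.commute)
      then have yd: "\<bar>y - xp\<bar> < d" "xp - d1 < y"
        using y(2) \<open>y \<le> xp\<close> \<open>d > 0\<close> d1(1) by linarith+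
      have "xp - h y 1 \<le> l2 * (xp - y)"
        by (rule d1(2)[OF yX yd(2) \<open>y \<le> xp\<close>])
      also have "\<dots> \<le> l2 * (t / l)"
        using y(2) l2 lam by (intro mult_left_mono) auto
      finally have gap: "r * t \<le> h y 1 - x"
        by (simp add: x_def r_def algebra_simps)
      moreover have "0 \<le> r * t" using \<open>r > 0\<close> t by simp
      ultimately have xh: "x \<le> h y 1" by linarith
      have "b * r ^ k * t ^ k \<le> b * (h y 1 - x) ^ k"
        using gap \<open>0 \<le> r * t\<close> \<open>b > 0\<close> power_mono[of "r * t" "h y 1 - x" k]
        by (simp add: power_mult_distrib)
      then show ?thesis using K[OF yX yd(1) x(3) xh] xh by auto
    qed
    have c: "0 \<le> b * r ^ k * t ^ k" using \<open>b > 0\<close> \<open>r > 0\<close> t by simp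
    have "ennreal (b * r ^ k * t ^ k * tail_mass (t / l)) = ennreal (b * r ^ k * t ^ k) * nn_tail (t / l)"
      using c tail_mass_nonneg by (simp add: nn_tail_eq ennreal_mult)
    also have "\<dots> = (\<integral>\<^sup>+y. ennreal (b * r ^ k * t ^ k) *
        (ennreal (\<phi> y) * indicator (M \<inter> {xp - t / l..}) y) \<partial>lborel)"
      unfolding nn_tail_def using nn_tail_measurable by (intro nn_integral_cmult[symmetric]) simp
    also have "\<dots> \<le> ennreal (\<phi> x)"
      unfolding \<phi>_eq[OF xM]
    proof (rule nn_integral_mono)
      fix y
      show "ennreal (b * r ^ k * t ^ k) * (ennreal (\<phi> y) * indicator (M \<inter> {xp - t / l..}) y)
        \<le> ennreal (noise_kernel h p x y * \<phi> y) * indicator {y \<in> M. h y (-1) \<le> x \<and> x \<le> h y 1} y"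
      proof (cases "y \<in> M \<and> xp - t / l \<le> y")
        case True
        have "b * r ^ k * t ^ k * \<phi> y \<le> noise_kernel h p x y * \<phi> y"
          using near[of y] True \<phi>_nonneg by (intro mult_right_mono) auto
        then have "ennreal (b * r ^ k * t ^ k) * ennreal (\<phi> y) \<le> ennreal (noise_kernel h p x y * \<phi> y)"
          using c True \<phi>_nonneg by (simp add: ennreal_mult[symmetric] ennreal_leI)
        then show ?thesis using True near[of y] by (simp add: indicator_def)
      qed (auto simp: indicator_def)
    qed
    finally have "b * r ^ k * t ^ k * tail_mass (t / l) \<le> \<phi> x"
      using \<phi>_nonneg[OF xM] by (subst (asm) ennreal_le_iff) auto
    then show "xp - t \<in> M \<and> b * r ^ k * t ^ k * tail_mass (t / l) \<le> \<phi> (xp - t)"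
      using xM by (simp add: x_def)
  qed
qed

section \<open>Self-bounds of the tail mass\<close>

text \<open>In \<open>s = xp - y\<close> the density bound is increasing, so its value at
  \<open>s = t\<close> serves on the whole tail; the length \<open>t\<close> of the tail supplies
  the extra power.\<close>

lemma tail_upper_bound:
  assumes l: "0 < l" "l < lam"
  obtains t0 B where "t0 > 0" "B > 0"
    "\<And>t. 0 < t \<Longrightarrow> t \<le> t0 \<Longrightarrow> xp - t \<in> M \<and> \<phi> (xp - t) \<le> B * t ^ k * tail_mass (t / l)"
    "\<And>t. 0 < t \<Longrightarrow> t \<le> t0 \<Longrightarrow> tail_mass t \<le> B * t ^ (k + 1) * tail_mass (t / l)"
proof -
  obtain t0 B where B: "t0 > 0" "B > 0"
    "\<And>t. 0 < t \<Longrightarrow> t \<le> t0 \<Longrightarrow> xp - t \<in> M \<and> \<phi> (xp - t) \<le> B * t ^ k * tail_mass (t / l)"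
    by (rule density_upper_bound[OF l]) blast
  have "tail_mass t \<le> B * t ^ (k + 1) * tail_mass (t / l)" if t: "0 < t" "t \<le> t0" for t
  proof -
    define c where "c = B * t ^ k * tail_mass (t / l)"
    have "c \<ge> 0" using B t tail_mass_nonneg by (simp add: c_def)
    have "nn_tail t \<le> (\<integral>\<^sup>+y. ennreal c * indicator {xp - t..xp} y \<partial>lborel)"
      unfolding nn_tail_def
    proof (rule nn_integral_mono_AE)
      show "AE y in lborel. ennreal (\<phi> y) * indicator (M \<inter> {xp - t..}) y
          \<le> ennreal c * indicator {xp - t..xp} y"
        \<comment> \<open>The density bound needs \<open>xp - y > 0\<close>, so the null set
          \<open>{xp}\<close> is discarded.\<close>
        using AE_lborel_singleton[of xp]
      proof eventually_elim
        case (elim y)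
        show ?case
        proof (cases "y \<in> M \<and> xp - t \<le> y")
          case True
          then have s: "0 < xp - y" "xp - y \<le> t" using M_le elim by force+
          have "\<phi> y \<le> B * (xp - y) ^ k * tail_mass ((xp - y) / l)"
            using B(3)[of "xp - y"] s t by simp
          also have "\<dots> \<le> c"
            unfolding c_def using s B(2) tail_mass_nonneg l
            by (intro mult_mono power_mono tail_mass_mono divide_right_mono) auto
          finally have "ennreal (\<phi> y) \<le> ennreal c" by (rule ennreal_leI)
          then show ?thesis using True M_le by (simp add: indicator_def)
        qed (auto simp: indicator_def)
      qed
    qed
    also have "\<dots> = ennreal c * ennreal t"
      using t by (simp add: nn_integral_cmult_indicator)
    finally have "ennreal (tail_mass t) \<le> ennreal (c * t)"
      using \<open>c \<ge> 0\<close> t by (simp add: nn_tail_eq ennreal_mult)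
    then have "tail_mass t \<le> c * t"
      using \<open>c \<ge> 0\<close> t by (subst (asm) ennreal_le_iff) auto
    then show ?thesis by (simp add: c_def mult_ac)
  qed
  then show thesis using that B by blast
qed

text \<open>Monotonicity in \<open>s = xp - y\<close> now works the wrong way, so only the slice
  \<open>q * t \<le> s \<le> t\<close> is integrated. The choice \<open>q = l1 / l\<close> gives
  \<open>s / l1 \<ge> q * t / l1 = t / l\<close>, so the truncation costs only the passage from
  \<open>l1\<close> to \<open>l\<close> and the factor \<open>q ^ k * (1 - q)\<close>.\<close>

lemma tail_lower_bound:
  assumes l: "lam < l"
  obtains t0 c c' where "t0 > 0" "c > 0" "c' > 0"
    "\<And>t. 0 < t \<Longrightarrow> t \<le> t0 \<Longrightarrow> xp - t \<in> M \<and> c * t ^ k * tail_mass (t / l) \<le> \<phi> (xp - t)"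
    "\<And>t. 0 < t \<Longrightarrow> t \<le> t0 \<Longrightarrow> c' * t ^ (k + 1) * tail_mass (t / l) \<le> tail_mass t"
proof -
  obtain l1 where l1: "lam < l1" "l1 < l"
    using dense[OF l] by blast
  define q where "q = l1 / l"
  have q: "0 < q" "q < 1" "l1 = q * l" "0 < l1" "0 < l"
    using l1 lam by (auto simp: q_def)
  obtain t0 c where c: "t0 > 0" "c > 0"
    "\<And>t. 0 < t \<Longrightarrow> t \<le> t0 \<Longrightarrow> xp - t \<in> M \<and> c * t ^ k * tail_mass (t / l1) \<le> \<phi> (xp - t)"
    by (rule density_lower_bound[OF l1(1)]) blast
  have "xp - t \<in> M \<and> c * t ^ k * tail_mass (t / l) \<le> \<phi> (xp - t)" if t: "0 < t" "t \<le> t0" for t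
  proof -
    have "t / l \<le> t / l1" using t l1 q by (intro divide_left_mono) auto
    then have "c * t ^ k * tail_mass (t / l) \<le> c * t ^ k * tail_mass (t / l1)"
      using c t by (intro mult_left_mono tail_mass_mono) auto
    then show ?thesis using c(3)[OF t] by auto
  qed
  moreover have "c * q ^ k * (1 - q) * t ^ (k + 1) * tail_mass (t / l) \<le> tail_mass t" if t: "0 < t" "t \<le> t0" for t
  proof -
    define a where "a = c * (q * t) ^ k * tail_mass (t / l)"
    have "a \<ge> 0" using c q t tail_mass_nonneg by (simp add: a_def)
    have "q * t \<le> t" using q t by (simp add: mult_le_cancel_right1)
    have "ennreal a * ennreal (t - q * t) = (\<integral>\<^sup>+y. ennreal a * indicator {xp - t..xp - q * t} y \<partial>lborel)"
      using \<open>q * t \<le> t\<close> by (simp add: nn_integral_cmult_indicator)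
    also have "\<dots> \<le> nn_tail t"
      unfolding nn_tail_def
    proof (rule nn_integral_mono)
      fix y
      show "ennreal a * indicator {xp - t..xp - q * t} y
          \<le> ennreal (\<phi> y) * indicator (M \<inter> {xp - t..}) y"
      proof (cases "y \<in> {xp - t..xp - q * t}")
        case True
        then have s: "q * t \<le> xp - y" "xp - y \<le> t" by auto
        moreover have "0 < q * t" using q t by simp
        ultimately have s0: "0 < xp - y" "xp - y \<le> t0" using t by linarith+
        have "t / l = q * t / l1" using q by simp
        also have "\<dots> \<le> (xp - y) / l1" using s q by (intro divide_right_mono) auto
        finally have "a \<le> c * (xp - y) ^ k * tail_mass ((xp - y) / l1)"
          unfolding a_def using s s0 \<open>0 < q * t\<close> c(2) tail_mass_nonneg
          by (intro mult_mono power_mono tail_mass_mono) auto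
        also have "\<dots> \<le> \<phi> y"
          using c(3)[OF s0] by simp
        finally have "ennreal a \<le> ennreal (\<phi> y)" by (rule ennreal_leI)
        moreover have "y \<in> M" using c(3)[OF s0] by simp
        ultimately show ?thesis using True by (simp add: indicator_def)
      qed (auto simp: indicator_def)
    qed
    finally have "ennreal (a * (t - q * t)) \<le> ennreal (tail_mass t)"
      using \<open>a \<ge> 0\<close> \<open>q * t \<le> t\<close> by (simp add: nn_tail_eq ennreal_mult)
    then have "a * (t - q * t) \<le> tail_mass t"
      using tail_mass_nonneg by (subst (asm) ennreal_le_iff) auto
    then show ?thesis by (simp add: a_def power_mult_distrib algebra_simps)
  qed
  moreover have "c * q ^ k * (1 - q) > 0" using c q by simp
  ultimately show thesis using that[OF c(1,2)] by blast
qed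

section \<open>Logarithmic coordinates and the limit\<close>

lemma eventually_at_xp:
  assumes "eventually (\<lambda>u. P (xp - exp (- u))) at_top"
  shows "eventually P (at xp within (M \<inter> {..<xp}))"
proof -
  have "filterlim (\<lambda>x. - ln (xp - x)) at_top (at_left xp)"
    by real_asymp
  then have "eventually (\<lambda>x. P (xp - exp (- (- ln (xp - x))))) (at_left xp)"
    by (rule eventually_compose_filterlim[OF assms])
  moreover have "at xp within (M \<inter> {..<xp}) \<le> at_left xp"
    by (rule at_le) simp
  ultimately have "eventually (\<lambda>x. P (xp - exp (- (- ln (xp - x))))) (at xp within (M \<inter> {..<xp}))"
    using filter_leD by blast
  moreover have "eventually (\<lambda>x. x < xp) (at xp within (M \<inter> {..<xp}))"
    by (simp add: eventually_at_filter)
  ultimately show ?thesis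
    by eventually_elim simp
qed

text \<open>Division by \<open>l\<close> is a shift in \<open>u\<close>. The form
  \<open>u - - ln l\<close> is \<open>u - L\<close> with \<open>L\<close> unfolded, so that the
  result matches the recursion literally.\<close>

lemma ln_tail_scaled:
  assumes "B > 0" "l > 0"
  shows "ln (B * exp (- u) ^ n * tail_mass (exp (- u) / l)) = ln B - real n * u + ln (tail_mass (exp (- (u - - ln l))))"
proof -
  have "exp (- (u - - ln l)) = exp (- u) / l"
    using assms by (simp add: exp_diff exp_minus exp_add field_simps)
  moreover have "ln (B * exp (- u) ^ n * tail_mass (exp (- u) / l)) = ln B + ln (exp (- u) ^ n) + ln (tail_mass (exp (- u) / l))"
    using assms tail_mass_pos[of "exp (- u) / l"] by (simp add: ln_mult_pos)
  moreover have "ln (exp (- u) ^ n) = - (real n * u)"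
    by (simp add: ln_realpow)
  ultimately show ?thesis by simp
qed

text \<open>The strict inequality leaves room: the candidate limit is continuous in the rate, so
  some \<open>l < lam\<close> still satisfies it, and the recursion with step \<open>- ln l\<close>
  gives exactly the value at \<open>l\<close>.\<close>

lemma log_density_less:
  assumes e: "(real k + 1) / (2 * ln lam) < e"
  shows "eventually (\<lambda>x. ln (\<phi> x) / (ln (xp - x))\<^sup>2 < e) (at xp within (M \<inter> {..<xp}))"
proof -
  have "((\<lambda>l. (real k + 1) / (2 * ln l)) \<longlongrightarrow> (real k + 1) / (2 * ln lam)) (at_left lam)"
    using lam by (intro tendsto_intros) auto
  then have "eventually (\<lambda>l. (real k + 1) / (2 * ln l) < e) (at_left lam)"
    by (rule order_tendstoD) (rule e)
  moreover have "eventually (\<lambda>l. l \<in> {0<..<lam}) (at_left lam)"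
    using lam by (intro eventually_at_left_real) auto
  ultimately have "eventually (\<lambda>l. (real k + 1) / (2 * ln l) < e \<and> l \<in> {0<..<lam}) (at_left lam)"
    by eventually_elim auto
  then obtain l where l: "(real k + 1) / (2 * ln l) < e" "0 < l" "l < lam"
    using eventually_happens'[of "at_left lam"] by fastforce
  define L where "L = - ln l"
  have "L > 0" using l lam by (simp add: L_def)
  obtain t1 B where "t1 > 0" "B > 0"
    and \<phi>: "\<And>t. 0 < t \<Longrightarrow> t \<le> t1 \<Longrightarrow> xp - t \<in> M \<and> \<phi> (xp - t) \<le> B * t ^ k * tail_mass (t / l)"
    and tail_le: "\<And>t. 0 < t \<Longrightarrow> t \<le> t1 \<Longrightarrow> tail_mass t \<le> B * t ^ (k + 1) * tail_mass (t / l)"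
    by (rule tail_upper_bound[OF l(2,3)]) blast
  \<comment> \<open>Since \<open>ln 0 = 0\<close>, positivity of \<open>\<phi>\<close> is needed before logarithms are compared.\<close>
  obtain t2 c where "t2 > 0" "c > 0"
    and low: "\<And>t. 0 < t \<Longrightarrow> t \<le> t2 \<Longrightarrow> xp - t \<in> M \<and> c * t ^ k * tail_mass (t / 1) \<le> \<phi> (xp - t)"
    by (rule density_lower_bound[OF lam(2)]) blast
  define u0 where "u0 = - ln (min t1 t2)"
  have u0: "exp (- u) \<le> t1" "exp (- u) \<le> t2" if "u \<ge> u0" for u
  proof -
    have "exp (- u) \<le> exp (ln (min t1 t2))"
      using that by (simp add: u0_def)
    also have "\<dots> = min t1 t2"
      using \<open>t1 > 0\<close> \<open>t2 > 0\<close> by simp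
    finally show "exp (- u) \<le> t1" "exp (- u) \<le> t2" by auto
  qed
  have "eventually (\<lambda>u. ln (\<phi> (xp - exp (- u))) / u\<^sup>2 < e) at_top"
  \<comment> \<open>The bound on the initial window is \<open>K = 0\<close>, because the tail mass
    is at most 1.\<close>
  proof (rule quadratic_growth_recursion[where a = "\<lambda>u. ln (tail_mass (exp (- u)))" and ?u0.0 = u0, OF \<open>L > 0\<close>])
    show "ln (tail_mass (exp (- u))) \<le> 0" for u
      using tail_mass_le_1 tail_mass_pos by simp
    show "ln (tail_mass (exp (- u))) \<le> ln B - real (k + 1) * u + ln (tail_mass (exp (- (u - L))))" if "u \<ge> u0" for u
    proof -
      have "ln (tail_mass (exp (- u))) \<le> ln (B * exp (- u) ^ (k + 1) * tail_mass (exp (- u) / l))"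
        using tail_le[of "exp (- u)"] u0[OF that] tail_mass_pos by (intro ln_mono) auto
      then show ?thesis
        unfolding ln_tail_scaled[OF \<open>B > 0\<close> l(2)] L_def .
    qed
    show "ln (\<phi> (xp - exp (- u))) \<le> ln B - real k * u + ln (tail_mass (exp (- (u - L))))" if "u \<ge> u0" for u
    proof -
      have "0 < c * exp (- u) ^ k * tail_mass (exp (- u) / 1)"
        using \<open>c > 0\<close> tail_mass_pos by simp
      also have "\<dots> \<le> \<phi> (xp - exp (- u))"
        using low[of "exp (- u)"] u0[OF that] by simp
      finally have "ln (\<phi> (xp - exp (- u))) \<le> ln (B * exp (- u) ^ k * tail_mass (exp (- u) / l))"
        using \<phi>[of "exp (- u)"] u0[OF that] by (intro ln_mono) auto
      then show ?thesis
        unfolding ln_tail_scaled[OF \<open>B > 0\<close> l(2)] L_def .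
    qed
    show "- real (k + 1) / (2 * L) < e"
    proof -
      have "- real (k + 1) / (2 * L) = (real k + 1) / (2 * ln l)"
        using \<open>L > 0\<close> by (simp add: L_def field_simps)
      then show ?thesis using l(1) by simp
    qed
  qed
  then show ?thesis
    by (intro eventually_at_xp) simp
qed

text \<open>The same recursion is applied to \<open>- ln (tail_mass (exp (- u)))\<close>, with drift
  of opposite sign \<open>m = - real (k + 1)\<close>. The rate is taken in
  \<open>{lam<..<1}\<close>; being below 1 it keeps the step \<open>L\<close> positive.\<close>

lemma log_density_greater:
  assumes e: "e < (real k + 1) / (2 * ln lam)"
  shows "eventually (\<lambda>x. e < ln (\<phi> x) / (ln (xp - x))\<^sup>2) (at xp within (M \<inter> {..<xp}))"
proof -
  have "((\<lambda>l. (real k + 1) / (2 * ln l)) \<longlongrightarrow> (real k + 1) / (2 * ln lam)) (at_right lam)"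
    using lam by (intro tendsto_intros) auto
  then have "eventually (\<lambda>l. e < (real k + 1) / (2 * ln l)) (at_right lam)"
    by (rule order_tendstoD) (rule e)
  moreover have "eventually (\<lambda>l. l \<in> {lam<..<1}) (at_right lam)"
    using lam by (intro eventually_at_right_real) auto
  ultimately have "eventually (\<lambda>l. e < (real k + 1) / (2 * ln l) \<and> l \<in> {lam<..<1}) (at_right lam)"
    by eventually_elim auto
  then obtain l where l: "e < (real k + 1) / (2 * ln l)" "lam < l" "l < 1"
    using eventually_happens'[of "at_right lam"] by fastforce
  have "0 < l" using l lam by simp
  define L where "L = - ln l"
  have "L > 0" using l lam by (simp add: L_def)
  obtain t0 c c' where "t0 > 0" "c > 0" "c' > 0"
    and \<phi>: "\<And>t. 0 < t \<Longrightarrow> t \<le> t0 \<Longrightarrow> xp - t \<in> M \<and> c * t ^ k * tail_mass (t / l) \<le> \<phi> (xp - t)"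
    and tail_ge: "\<And>t. 0 < t \<Longrightarrow> t \<le> t0 \<Longrightarrow> c' * t ^ (k + 1) * tail_mass (t / l) \<le> tail_mass t"
    by (rule tail_lower_bound[OF l(2)]) blast
  define u0 where "u0 = - ln t0"
  have u0: "exp (- u) \<le> t0" if "u \<ge> u0" for u
  proof -
    have "exp (- u) \<le> exp (ln t0)"
      using that by (simp add: u0_def)
    then show ?thesis using \<open>t0 > 0\<close> by simp
  qed
  have "eventually (\<lambda>u. - ln (\<phi> (xp - exp (- u))) / u\<^sup>2 < - e) at_top"
  proof (rule quadratic_growth_recursion[where a = "\<lambda>u. - ln (tail_mass (exp (- u)))" and ?u0.0 = u0, OF \<open>L > 0\<close>])
    \<comment> \<open>On the initial window \<open>exp (- u) \<ge> exp (- u0)\<close>, so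
      monotonicity and positivity of the tail mass give a finite bound, attained at
      \<open>u0\<close>.\<close>
    show "- ln (tail_mass (exp (- u))) \<le> - ln (tail_mass (exp (- u0)))" if "u \<in> {u0 - L..u0}" for u
      using that tail_mass_pos tail_mass_mono[of "exp (- u0)" "exp (- u)"] by simp
    show "- ln (tail_mass (exp (- u))) \<le> - ln c' - (- real (k + 1)) * u + - ln (tail_mass (exp (- (u - L))))"
      if "u \<ge> u0" for u
    proof -
      have "ln (c' * exp (- u) ^ (k + 1) * tail_mass (exp (- u) / l)) \<le> ln (tail_mass (exp (- u)))"
        using tail_ge[of "exp (- u)"] u0[OF that] tail_mass_pos \<open>0 < l\<close> \<open>c' > 0\<close> by (intro ln_mono) auto
      then show ?thesis
        unfolding ln_tail_scaled[OF \<open>c' > 0\<close> \<open>0 < l\<close>] L_def by (simp add: algebra_simps)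
    qed
    show "- ln (\<phi> (xp - exp (- u))) \<le> - ln c - (- real k) * u + - ln (tail_mass (exp (- (u - L))))"
      if "u \<ge> u0" for u
    proof -
      have "ln (c * exp (- u) ^ k * tail_mass (exp (- u) / l)) \<le> ln (\<phi> (xp - exp (- u)))"
        using \<phi>[of "exp (- u)"] u0[OF that] tail_mass_pos \<open>0 < l\<close> \<open>c > 0\<close> by (intro ln_mono) auto
      then show ?thesis
        unfolding ln_tail_scaled[OF \<open>c > 0\<close> \<open>0 < l\<close>] L_def by (simp add: algebra_simps)
    qed
    show "- (- real (k + 1)) / (2 * L) < - e"
    proof -
      have "- (- real (k + 1)) / (2 * L) = - ((real k + 1) / (2 * ln l))"
        using \<open>L > 0\<close> by (simp add: L_def field_simps)
      then show ?thesis using l(1) by simp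
    qed
  qed
  then show ?thesis
    by (intro eventually_at_xp) simp
qed

end

theorem theorem1:
  fixes X M :: "real set"
    and h :: "real \<Rightarrow> real \<Rightarrow> real"
    and \<nu> \<mu> :: "real measure"
    and p \<phi> :: "real \<Rightarrow> real"
    and k :: nat
    and xp lam :: real
  assumes "random_difference_equation X h \<nu>"
    and "H1 X h"
    and "H2 \<nu> p k"
    and "stationary_distribution X h \<nu> \<mu>"
    and "is_interval M"
    and "M \<subseteq> X"
    and "M = measure_support \<mu>"
    and "stationary_density X h p \<mu> M \<phi>"
    and "local_Ck_diffeomorphism_on 2 (upper_map h) X"
    and "bdd_above M"
    and "xp = Sup M"
    and "hyperbolic_fixed_point_on (upper_map h) X xp"
    and "0 < lam" and "lam < 1"
    and "(\<lambda>x. upper_map h x - (xp + lam * (x - xp))) \<in> o[at xp within X](\<lambda>x. xp - x)"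
  shows "((\<lambda>x. ln (\<phi> x) / (ln (xp - x))\<^sup>2) \<longlongrightarrow> (real k + 1) / (2 * ln lam))
           (at xp within (M \<inter> {..<xp}))"
proof -
  have "prob_space \<mu>"
    using assms(4) by (simp add: stationary_distribution_def)
  moreover have "xp \<in> X" "h xp 1 = xp"
    using assms(12) by (simp_all add: hyperbolic_fixed_point_on_def upper_map_def)
  ultimately interpret stationary_setting X M h \<nu> \<mu> p \<phi> k xp lam
    using assms by (intro stationary_setting.intro)
  show ?thesis
    by (auto intro!: order_tendstoI log_density_greater log_density_less)
qed

end
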